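(* Let $n\ge 1$, let $T>0$, let $G \in \mathcal{G}^n$ be a graph, let $L \in \mathcal{L}(G)$ and $x_0 \in \mathbb{R}^{n}$. Put $X:=-L$ and define $$P := \int_0^{T} e^{Xt} x_0 x_0^\top e^{Xt}\, dt, \qquad Q := x_T x_T^\top - x_0 x_0^\top, \qquad x_T := e^{XT}x_0.$$ Then the network reconstruction problem is solvable for $(x_0,-L,-\mathcal{L})$ if and only if there exists a unique solution $S$ to $$SP + PS = Q, \quad S \in \mathbb{S}^n, \quad S \mathbf{1} = 0, \quad S_{ij} \geq 0 \text{ for all } i \neq j.$$ Moreover, under this condition, we have $S = -L$.
   Context: $\mathbb{S}^n$ is the set of real symmetric $n\times n$ matrices; $\mathbf{1}\in\mathbb{R}^n$ is the vector of ones. $\mathcal{G}^n$ is the set of simple undirected graphs (no self-loops, at most one edge between any pair of vertices) with vertex set $V=\{1,\dots,n\}$. For $G\in\mathcal{G}^n$ with edge set $E$, the qualitative class is $\mathcal{Q}(G) := \{X \in \mathbb{S}^n \mid \text{for all } i \neq j,\ X_{ij} \neq 0 \iff (i,j) \in E\}$, and the set of (weighted) Laplacian matrices of $G$ is $\mathcal{L}(G) := \{L \in \mathcal{Q}(G) \mid L\mathbf{1} = 0 \text{ and for all } i \neq j,\ L_{ij} \leq 0\}$. The set-valued map $-\mathcal{L}:\mathcal{G}^n\to 2^{\mathbb{S}^n}$ is given by $(-\mathcal{L})(G)=\{-L\mid L\in\mathcal{L}(G)\}$. The image of a set-valued map $\mathcal{K} : \mathcal{G}^n \to 2^{\mathbb{S}^n}$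 is $\operatorname{im}\mathcal{K} := \{Y \in \mathbb{S}^n \mid \exists\, G\in\mathcal{G}^n \text{ such that } Y \in \mathcal{K}(G)\}$. Solvability: for $x_0\in\mathbb{R}^n$ and $X\in\operatorname{im}\mathcal{K}$, let $x_{x_0}(t)=e^{Xt}x_0$ be the solution of $\dot x(t)=Xx(t)$ for $t\ge 0$, $x(0)=x_0$. The network reconstruction problem is said to be solvable for $(x_0,X,\mathcal{K})$ if for every $\bar X\in\operatorname{im}\mathcal{K}$ such that $x_{x_0}(\cdot)$ is a solution to $\dot x(t)=\bar X x(t)$ for $t\in[0,T]$, we have $\bar X=X$. Here $T>0$ is a fixed real number (the same $T$ as in the definition of $P$ and $Q$). *)

theory Defs
  imports "HOL-Analysis.Analysis"
begin

text \<open>A graph on the vertex set \<open>UNIV :: 'n set\<close> (with \<open>n = CARD('n)\<close>) is represented by its edge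
  set, an irreflexive symmetric relation: \<open>(i, j)\<close> and \<open>(j, i)\<close> stand for the same undirected edge.\<close>

type_synonym 'n graph = "('n \<times> 'n) set"

definition simple_graphs :: "'n graph set" where
  "simple_graphs = {E. irrefl E \<and> sym E}"

definition sym_matrices :: "(real^'n^'n) set" where
  "sym_matrices = {X. transpose X = X}"

definition qualitative_class :: "'n::finite graph \<Rightarrow> (real^'n^'n) set" where
  "qualitative_class E =
     {X \<in> sym_matrices. \<forall>i j. i \<noteq> j \<longrightarrow> (X $ i $ j \<noteq> 0 \<longleftrightarrow> (i, j) \<in> E)}"

text \<open>At vector type, \<open>1\<close> is the vector of ones.\<close>

definition laplacians :: "'n::finite graph \<Rightarrow> (real^'n^'n) set" where
  "laplacians E =
     {L \<in> qualitative_class E. L *v 1 = 0 \<and> (\<forall>i j. i \<noteq> j \<longrightarrow> L $ i $ j \<le> 0)}"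

definition neg_laplacians :: "'n::finite graph \<Rightarrow> (real^'n^'n) set" where
  "neg_laplacians E = {- L | L. L \<in> laplacians E}"

definition map_image :: "('n::finite graph \<Rightarrow> (real^'n^'n) set) \<Rightarrow> (real^'n^'n) set" where
  "map_image K = {Y \<in> sym_matrices. \<exists>E \<in> simple_graphs. Y \<in> K E}"

text \<open>The class operations \<open>exp\<close>, \<open>*\<close>, \<open>^\<close> and \<open>1\<close> are either unavailable or componentwise on
  \<open>real^'n^'n\<close>, hence the explicit power series for the matrix product \<open>**\<close>.\<close>

definition mat_exp :: "real^'n^'n \<Rightarrow> real^'n^'n" where
  "mat_exp A = (\<Sum>k. (1 / fact k) *\<^sub>R (((**) A) ^^ k) (mat 1))"

definition outer_product :: "real^'n \<Rightarrow> real^'n \<Rightarrow> real^'n^'n" where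
  "outer_product x y = (\<chi> i j. x $ i * y $ j)"

definition trajectory :: "real^'n \<Rightarrow> real^'n^'n \<Rightarrow> real \<Rightarrow> real^'n" where
  "trajectory x0 X t = mat_exp (t *\<^sub>R X) *v x0"

text \<open>At the end points of \<open>[0, T]\<close> the derivative is one-sided.\<close>

definition solves_on :: "real \<Rightarrow> (real \<Rightarrow> real^'n) \<Rightarrow> real^'n^'n \<Rightarrow> bool" where
  "solves_on T x A \<longleftrightarrow>
     (\<forall>t \<in> {0..T}. (x has_vector_derivative (A *v x t)) (at t within {0..T}))"

text \<open>Meant for \<open>T > 0\<close> and \<open>X \<in> map_image K\<close>.\<close>

definition reconstruction_solvable ::
  "real \<Rightarrow> real^'n \<Rightarrow> real^'n^'n \<Rightarrow> ('n::finite graph \<Rightarrow> (real^'n^'n) set) \<Rightarrow> bool" where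
  "reconstruction_solvable T x0 X K \<longleftrightarrow>
     (\<forall>Xbar \<in> map_image K. solves_on T (trajectory x0 X) Xbar \<longrightarrow> Xbar = X)"

definition constrained_solution ::
  "real^'n^'n \<Rightarrow> real^'n^'n \<Rightarrow> real^'n^'n \<Rightarrow> bool" where
  "constrained_solution P Q S \<longleftrightarrow>
     S ** P + P ** S = Q \<and> S \<in> sym_matrices \<and> S *v 1 = 0 \<and>
     (\<forall>i j. i \<noteq> j \<longrightarrow> S $ i $ j \<ge> 0)"

end

theory Submission
  imports Defs
begin

text \<open>Along a solution \<open>x\<close> of \<open>x' = S x\<close> with \<open>S\<close> symmetric, \<open>S x x\<^sup>T + x x\<^sup>T S\<close> is the derivative
  of \<open>x x\<^sup>T\<close>, so integrating gives \<open>S P + P S = Q\<close>. Conversely, if \<open>S P + P S = Q\<close>, then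
  \<open>D = S - X\<close> satisfies \<open>D P + P D = 0\<close>, and multiplying by \<open>D\<close> and taking traces yields
  \<open>2 \<integral> \<parallel>D x\<parallel>\<^sup>2 = 0\<close>. Hence \<open>D x = 0\<close> on \<open>[0, T]\<close>, that is, \<open>x' = S x\<close>. The constrained solutions
  are therefore exactly the matrices in the image of \<open>neg_laplacians\<close> which explain the data.\<close>

section \<open>The matrix exponential\<close>

text \<open>The entries may themselves be vectors, so applying the rule twice reduces the derivative
  of a matrix-valued function to its real entries, where theorems on real power series
  apply.\<close>

lemma has_vector_derivative_componentwise_cart:
  fixes f :: "real \<Rightarrow> 'a::euclidean_space ^ 'n"
  assumes "\<And>i. ((\<lambda>t. f t $ i) has_vector_derivative f' $ i) (at t within S)"
  shows "(f has_vector_derivative f') (at t within S)"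
proof -
  have "((\<lambda>t. f t \<bullet> b) has_derivative (\<lambda>h. (h *\<^sub>R f') \<bullet> b)) (at t within S)" if b: "b \<in> Basis" for b
  proof -
    obtain i u where bu: "b = axis i u" "u \<in> Basis"
      using b by (auto simp: Basis_vec_def)
    have "((\<lambda>t. f t $ i) has_derivative (\<lambda>h. h *\<^sub>R f' $ i)) (at t within S)"
      using assms[of i] by (simp add: has_vector_derivative_def)
    then have "((\<lambda>t. f t $ i \<bullet> u) has_derivative (\<lambda>h. (h *\<^sub>R f' $ i) \<bullet> u)) (at t within S)"
      by (rule has_derivative_inner_left)
    then show ?thesis
      by (simp add: bu inner_axis)
  qed
  then show ?thesis
    unfolding has_vector_derivative_def by (subst has_derivative_componentwise_within) blast
qed

lemma bounded_bilinear_matrix_matrix_mult: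
  "bounded_bilinear ((**) :: real^'m^'n \<Rightarrow> real^'p^'m \<Rightarrow> real^'p^'n)"
  unfolding bilinear_conv_bounded_bilinear[symmetric] bilinear_def
  by (auto intro!: linearI simp: matrix_matrix_mult_def vec_eq_iff sum.distrib sum_distrib_left
      distrib_left distrib_right mult_ac)

abbreviation matrix_power :: "real^'n^'n \<Rightarrow> nat \<Rightarrow> real^'n^'n" where
  "matrix_power A k \<equiv> (((**) A) ^^ k) (mat 1)"

lemma matrix_power_scaleR: "matrix_power (t *\<^sub>R A) k = t ^ k *\<^sub>R matrix_power A k"
  by (induction k) (simp_all add: matrix_scalar_ac scalar_matrix_assoc[symmetric])

text \<open>Powers are built by multiplying on the left, whereas transposition turns this into
  multiplication on the right; this lemma reconciles the two.\<close>

lemma matrix_power_commute: "matrix_power A k ** A = A ** matrix_power A k"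
  by (induction k) (simp_all add: matrix_mul_assoc[symmetric])

lemma transpose_matrix_power:
  "transpose (matrix_power A k) = matrix_power (transpose A) k"
  by (induction k) (simp_all add: matrix_transpose_mul transpose_mat matrix_power_commute)

text \<open>Bounded bilinearity of the product yields a constant \<open>K\<close> such that each
  further factor \<open>A\<close> costs at most \<open>K * norm A\<close>. This geometric bound lets
  a real exponential series dominate the matrix one.\<close>

lemma norm_matrix_power_le:
  obtains K where "K \<ge> 0"
    "\<And>k. norm (matrix_power (A::real^'n^'n) k) \<le> (K * norm A) ^ k * norm (mat 1 :: real^'n^'n)"
proof -
  obtain K where K: "K \<ge> 0" and mult: "\<And>(B::real^'n^'n) (C::real^'n^'n). norm (B ** C) \<le> norm B * norm C * K"
    using bounded_bilinear.nonneg_bounded[OF bounded_bilinear_matrix_matrix_mult] by blast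
  have "norm (matrix_power A k) \<le> (K * norm A) ^ k * norm (mat 1 :: real^'n^'n)" for k
  proof (induction k)
    case (Suc k)
    have "norm (matrix_power A (Suc k)) \<le> (K * norm A) * norm (matrix_power A k)"
      using mult[of A "matrix_power A k"] by (simp add: mult_ac)
    also have "\<dots> \<le> (K * norm A) * ((K * norm A) ^ k * norm (mat 1 :: real^'n^'n))"
      using Suc K by (intro mult_left_mono) auto
    finally show ?case by (simp add: mult_ac)
  qed simp
  with K show thesis by (rule that)
qed

lemma summable_mat_exp:
  "summable (\<lambda>k. (1 / fact k) *\<^sub>R matrix_power (A::real^'n^'n) k)"
proof -
  obtain K where K: "K \<ge> 0"
    "\<And>k. norm (matrix_power A k) \<le> (K * norm A) ^ k * norm (mat 1 :: real^'n^'n)"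
    using norm_matrix_power_le[where A = A] by blast
  have "summable (\<lambda>k. inverse (fact k) * (K * norm A) ^ k * norm (mat 1 :: real^'n^'n))"
    by (intro summable_mult2 summable_exp)
  then show ?thesis
  proof (rule summable_comparison_test')
    show "norm ((1 / fact k) *\<^sub>R matrix_power A k)
        \<le> inverse (fact k) * (K * norm A) ^ k * norm (mat 1 :: real^'n^'n)" for k
      using mult_left_mono[OF K(2)[of k], of "inverse (fact k)"]
      by (simp add: divide_inverse mult_ac)
  qed
qed

lemma mat_exp_sums: "(\<lambda>k. (1 / fact k) *\<^sub>R matrix_power A k) sums mat_exp A"
  unfolding mat_exp_def by (rule summable_sums[OF summable_mat_exp])

text \<open>With the scalar \<open>t\<close> pulled out of the powers, each entry is an ordinary
  power series in \<open>t\<close>, ready for termwise differentiation.\<close>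

lemma mat_exp_sums_component:
  "(\<lambda>k. matrix_power A k $ i $ j / fact k * t ^ k) sums mat_exp (t *\<^sub>R A) $ i $ j"
  using sums_vec_nth[OF sums_vec_nth[OF mat_exp_sums[of "t *\<^sub>R A"]], of i j]
  by (simp add: matrix_power_scaleR mult_ac)

lemma mat_exp_0: "mat_exp 0 = mat 1"
proof -
  have "matrix_power 0 k = 0" if "k \<noteq> 0" for k
    using that by (cases k) auto
  then have "(\<lambda>k. (1 / fact k) *\<^sub>R matrix_power 0 k) sums (\<Sum>k\<in>{0}. (1 / fact k) *\<^sub>R matrix_power 0 k)"
    by (intro sums_finite) auto
  then show ?thesis
    using mat_exp_sums sums_unique2 by fastforce
qed

lemma transpose_mat_exp: "transpose (mat_exp A) = mat_exp (transpose A)"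
proof -
  have "mat_exp A $ j $ i = mat_exp (transpose A) $ i $ j" for i j
  proof -
    have "matrix_power A k $ j $ i = matrix_power (transpose A) k $ i $ j" for k
      using arg_cong[OF transpose_matrix_power[of k A], of "\<lambda>M. M $ i $ j"] by (simp add: transpose_def)
    \<comment> \<open>The factor \<open>1 ^ k\<close> matches the entrywise series at
      \<open>t = 1\<close>, so that uniqueness of sums identifies the two entries.\<close>
    then have "(\<lambda>k. matrix_power A k $ j $ i / fact k * 1 ^ k) sums mat_exp (transpose A) $ i $ j"
      using mat_exp_sums_component[of "transpose A" i j 1] by simp
    then show ?thesis
      using mat_exp_sums_component[of A j i 1] sums_unique2 by fastforce
  qed
  then show ?thesis
    by (simp add: transpose_def vec_eq_iff)
qed

lemma has_vector_derivative_mat_exp: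
  "((\<lambda>t. mat_exp (t *\<^sub>R A)) has_vector_derivative A ** mat_exp (t *\<^sub>R A)) (at t within S)"
proof (intro has_vector_derivative_componentwise_cart)
  fix i j
  define c where "c i j k = matrix_power A k $ i $ j / fact k" for i j k
  have sums: "(\<lambda>k. c i j k * s ^ k) sums mat_exp (s *\<^sub>R A) $ i $ j" for i j s
    unfolding c_def by (rule mat_exp_sums_component)
  \<comment> \<open>\<open>diffs\<close> multiplies the coefficient of index \<open>Suc k\<close> by
    \<open>Suc k\<close>, which cancels against \<open>fact (Suc k)\<close> and leaves
    \<open>fact k\<close> and one extra factor \<open>A\<close> on the left.\<close>
  have "diffs (c i j) k = (A ** matrix_power A k) $ i $ j / fact k" for k
    by (simp add: diffs_def c_def del: of_nat_Suc)
  then have "diffs (c i j) k = (\<Sum>l\<in>UNIV. A $ i $ l * c l j k)" for k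
    by (simp add: c_def matrix_matrix_mult_def sum_divide_distrib)
  then have "(\<lambda>k. diffs (c i j) k * t ^ k) sums (\<Sum>l\<in>UNIV. A $ i $ l * mat_exp (t *\<^sub>R A) $ l $ j)"
    using sums_sum[of UNIV "\<lambda>l k. A $ i $ l * (c l j k * t ^ k)"] sums_mult[OF sums]
    by (simp add: sum_distrib_right mult.assoc)
  then have "(\<Sum>k. diffs (c i j) k * t ^ k) = (A ** mat_exp (t *\<^sub>R A)) $ i $ j"
    by (simp add: matrix_matrix_mult_def sums_iff)
  moreover have "((\<lambda>s. \<Sum>k. c i j k * s ^ k) has_field_derivative (\<Sum>k. diffs (c i j) k * t ^ k)) (at t)"
    using sums by (intro termdiffs_strong_converges_everywhere) (auto simp: sums_iff)
  moreover have "(\<lambda>s. \<Sum>k. c i j k * s ^ k) = (\<lambda>s. mat_exp (s *\<^sub>R A) $ i $ j)"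
    using sums by (auto simp: sums_iff)
  ultimately show "((\<lambda>s. mat_exp (s *\<^sub>R A) $ i $ j) has_vector_derivative
      (A ** mat_exp (t *\<^sub>R A)) $ i $ j) (at t within S)"
    by (simp add: has_real_derivative_iff_has_vector_derivative[symmetric] has_field_derivative_at_within)
qed

lemma trajectory_0: "trajectory x0 X 0 = x0"
  by (simp add: trajectory_def mat_exp_0)

lemma solves_on_trajectory: "solves_on T (trajectory x0 X) X"
proof -
  have "linear (\<lambda>M::real^'a^'a. M *v x0)"
    by (rule linearI) (simp_all add: matrix_vector_mult_add_rdistrib scaleR_matrix_vector_assoc)
  then have "bounded_linear (\<lambda>M::real^'a^'a. M *v x0)"
    by (simp add: linear_conv_bounded_linear)
  from bounded_linear.has_vector_derivative[OF this has_vector_derivative_mat_exp[of X]]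
  show ?thesis
    by (simp add: solves_on_def trajectory_def[abs_def] matrix_vector_mul_assoc)
qed

section \<open>The Lyapunov equation\<close>

lemma matrix_mult_outer_product: "A ** outer_product x y = outer_product (A *v x) y"
  by (simp add: outer_product_def matrix_matrix_mult_def matrix_vector_mult_def vec_eq_iff
      sum_distrib_right mult.assoc)

lemma outer_product_matrix_mult: "outer_product x y ** A = outer_product x (transpose A *v y)"
  by (simp add: outer_product_def matrix_matrix_mult_def matrix_vector_mult_def transpose_def
      vec_eq_iff sum_distrib_left mult_ac)

lemma trace_outer_product: "trace (outer_product x y) = x \<bullet> y"
  by (simp add: trace_def outer_product_def inner_vec_def)

lemma bounded_bilinear_outer_product:
  "bounded_bilinear (outer_product :: real^'n \<Rightarrow> real^'n \<Rightarrow> real^'n^'n)"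
  unfolding bilinear_conv_bounded_bilinear[symmetric] bilinear_def
  by (auto intro!: linearI simp: outer_product_def vec_eq_iff algebra_simps)

lemma continuous_on_outer_product:
  assumes "continuous_on S x" "continuous_on S y"
  shows "continuous_on S (\<lambda>t. outer_product (x t :: real^'n) (y t))"
  using bounded_bilinear.continuous_on[OF bounded_bilinear_outer_product assms] .

text \<open>This permits the Lyapunov operator to be moved inside the integral that defines
  \<open>P\<close>.\<close>

lemma bounded_linear_lyapunov:
  fixes S :: "real^'n^'n"
  shows "bounded_linear (\<lambda>P. S ** P + P ** S)"
  using bounded_bilinear_matrix_matrix_mult
  by (intro bounded_linear_add bounded_bilinear.bounded_linear_left bounded_bilinear.bounded_linear_right)

lemma bounded_linear_trace: "bounded_linear (trace :: real^'n^'n \<Rightarrow> real)"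
  unfolding linear_conv_bounded_linear[symmetric]
  by (auto intro!: linearI simp: trace_def sum.distrib sum_distrib_left)

lemma continuous_on_solution:
  assumes "solves_on T x S"
  shows "continuous_on {0..T} x"
  unfolding continuous_on_eq_continuous_within
  using assms has_vector_derivative_continuous by (fastforce simp: solves_on_def)

lemma lyapunov_equation_of_solution:
  fixes S :: "real^'n^'n"
  assumes sol: "solves_on T x S" and S: "S \<in> sym_matrices" and "0 \<le> T"
    and P: "P = integral {0..T} (\<lambda>t. outer_product (x t) (x t))"
  shows "S ** P + P ** S = outer_product (x T) (x T) - outer_product (x 0) (x 0)"
proof -
  let ?O = "\<lambda>t. outer_product (x t) (x t)"
  have "(?O has_vector_derivative (S ** ?O t + ?O t ** S)) (at t within {0..T})"
    if "t \<in> {0..T}" for t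
  proof -
    have "(x has_vector_derivative S *v x t) (at t within {0..T})"
      using sol that by (simp add: solves_on_def)
    from bounded_bilinear.has_vector_derivative[OF bounded_bilinear_outer_product this this]
    \<comment> \<open>The product rule gives the outer products of \<open>x t\<close> with
      \<open>S *v x t\<close> in both orders; symmetry of \<open>S\<close> turns the one with
      \<open>S\<close> in the second factor into \<open>?O t ** S\<close>.\<close>
    have "(?O has_vector_derivative (?O t ** S + S ** ?O t)) (at t within {0..T})"
      using S by (simp add: matrix_mult_outer_product outer_product_matrix_mult sym_matrices_def)
    then show ?thesis
      by (simp only: add.commute)
  qed
  with \<open>0 \<le> T\<close> have "((\<lambda>t. S ** ?O t + ?O t ** S) has_integral ?O T - ?O 0) {0..T}"
    by (rule fundamental_theorem_of_calculus)
  moreover have "?O integrable_on {0..T}"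
    by (intro integrable_continuous_interval continuous_on_outer_product continuous_on_solution[OF sol])
  then have "(?O has_integral P) {0..T}"
    unfolding P by (rule integrable_integral)
  from has_integral_linear[OF this bounded_linear_lyapunov[of S]]
  have "((\<lambda>t. S ** ?O t + ?O t ** S) has_integral S ** P + P ** S) {0..T}"
    by (simp only: o_def)
  ultimately show ?thesis
    by (rule has_integral_unique[rotated])
qed

lemma lyapunov_kernel:
  fixes T :: real and D :: "real^'n^'n"
  assumes cont: "continuous_on {0..T} x" and D: "D \<in> sym_matrices" and "0 < T"
    and P: "P = integral {0..T} (\<lambda>t. outer_product (x t) (x t))"
    and eq: "D ** P + P ** D = 0" and t: "t \<in> {0..T}"
  shows "D *v x t = 0"
proof -
  let ?O = "\<lambda>t. outer_product (x t) (x t)"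
  \<comment> \<open>A linear functional evaluated in two ways: it vanishes at \<open>P\<close> by
    the equation, and under the integral it produces a sum of squares.\<close>
  let ?F = "\<lambda>M. trace (D ** (D ** M + M ** D))"
  have DT: "transpose D = D"
    using D by (simp add: sym_matrices_def)
  have "bounded_linear ?F"
    by (intro bounded_linear_compose[OF bounded_linear_trace]
        bounded_linear_compose[OF bounded_bilinear.bounded_linear_right[OF bounded_bilinear_matrix_matrix_mult]]
        bounded_linear_lyapunov)
  moreover have "?O integrable_on {0..T}"
    by (intro integrable_continuous_interval continuous_on_outer_product cont)
  then have "(?O has_integral P) {0..T}"
    unfolding P by (rule integrable_integral)
  ultimately have "((\<lambda>t. ?F (?O t)) has_integral ?F P) {0..T}"
    unfolding o_def[symmetric, of ?F ?O] by (intro has_integral_linear)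
  moreover have "?F P = 0"
    by (simp add: eq trace_def)
  moreover have "?F (?O t) = 2 * (norm (D *v x t))\<^sup>2" for t
  proof -
    \<comment> \<open>The two summands of the trace are \<open>D *v (D *v x t)\<close> against
      \<open>x t\<close> and \<open>D *v x t\<close> against itself; symmetry of \<open>D\<close>
      makes them equal.\<close>
    have "(D *v (D *v x t)) \<bullet> x t = (D *v x t) \<bullet> (D *v x t)"
      using dot_lmul_matrix[of "D *v x t" D "x t"] by (metis DT transpose_matrix_vector)
    then show ?thesis
      by (simp add: matrix_add_ldistrib matrix_mult_outer_product outer_product_matrix_mult DT
          trace_add trace_outer_product power2_norm_eq_inner)
  qed
  ultimately have "((\<lambda>t. 2 * (norm (D *v x t))\<^sup>2) has_integral 0) {0..T}"
    by simp
  moreover have "continuous_on {0..T} (\<lambda>t. 2 * (norm (D *v x t))\<^sup>2)"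
    by (intro continuous_intros cont bounded_linear.continuous_on[OF matrix_vector_mul_bounded_linear])
  \<comment> \<open>A continuous nonnegative function with zero integral over a nondegenerate
    interval vanishes at every point of it.\<close>
  ultimately have "\<forall>s \<in> {0..T}. 2 * (norm (D *v x s))\<^sup>2 = 0"
    using \<open>0 < T\<close> by (subst integral_eq_0_iff[symmetric]) (simp_all only: integral_unique, simp)
  with t show ?thesis by simp
qed

lemma solution_of_lyapunov_equation:
  fixes S X :: "real^'n^'n"
  assumes sol: "solves_on T x X" and X: "X \<in> sym_matrices" and S: "S \<in> sym_matrices" and "0 < T"
    and P: "P = integral {0..T} (\<lambda>t. outer_product (x t) (x t))"
    and eq: "S ** P + P ** S = outer_product (x T) (x T) - outer_product (x 0) (x 0)"
  shows "solves_on T x S"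
proof -
  have "S - X \<in> sym_matrices"
    using S X by (simp add: sym_matrices_def transpose_def vec_eq_iff)
  moreover have "(S - X) ** P + P ** (S - X) = (S ** P + P ** S) - (X ** P + P ** X)"
    using bounded_bilinear.diff_left[OF bounded_bilinear_matrix_matrix_mult, of S X P]
      bounded_bilinear.diff_right[OF bounded_bilinear_matrix_matrix_mult, of P S X] by simp
  \<comment> \<open>\<open>X\<close> satisfies the same equation as \<open>S\<close>, because
    \<open>x\<close> solves its system.\<close>
  then have "(S - X) ** P + P ** (S - X) = 0"
    using lyapunov_equation_of_solution[OF sol X _ P] eq \<open>0 < T\<close> by simp
  ultimately have "(S - X) *v x t = 0" if "t \<in> {0..T}" for t
    using lyapunov_kernel[OF continuous_on_solution[OF sol] _ \<open>0 < T\<close> P] that by blast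
  then have "S *v x t = X *v x t" if "t \<in> {0..T}" for t
    using that by (simp add: matrix_vector_mult_diff_rdistrib)
  with sol show ?thesis
    by (simp add: solves_on_def)
qed

section \<open>Reconstruction of the Laplacian\<close>

text \<open>The graph is not prescribed, and any symmetric matrix can be read as supported on the
  graph of its nonzero off-diagonal entries. Only the linear constraints of
  \<open>constrained_solution\<close> therefore remain.\<close>

lemma map_image_neg_laplacians:
  "map_image neg_laplacians =
     {S \<in> sym_matrices. S *v 1 = 0 \<and> (\<forall>i j. i \<noteq> j \<longrightarrow> S $ i $ j \<ge> 0)}" (is "?I = ?C")
proof
  have neg: "(- L) *v 1 = - (L *v 1)" for L :: "real^'n^'n"
    by (simp add: matrix_vector_mult_def vec_eq_iff sum_negf)
  show "?I \<subseteq> ?C"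
    by (auto simp: map_image_def neg_laplacians_def laplacians_def neg)
  show "?C \<subseteq> ?I"
  proof
    fix S assume S: "S \<in> ?C"
    define E where "E = {(i, j). i \<noteq> j \<and> S $ i $ j \<noteq> 0}"
    have comm: "S $ i $ j = S $ j $ i" for i j
      using S by (simp add: sym_matrices_def transpose_def vec_eq_iff)
    have "E \<in> simple_graphs"
      by (auto simp: simple_graphs_def irrefl_def sym_def E_def comm)
    moreover have "- S \<in> laplacians E"
      using S by (auto simp: laplacians_def qualitative_class_def E_def neg sym_matrices_def
          transpose_def vec_eq_iff)
    then have "S \<in> neg_laplacians E"
      unfolding neg_laplacians_def by (metis (mono_tags, lifting) add.inverse_inverse mem_Collect_eq)
    ultimately show "S \<in> ?I"
      using S by (auto simp: map_image_def)
  qed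
qed

theorem corollary10:
  fixes T :: real and G :: "'n::finite graph"
    and L X P Q :: "real^'n^'n" and x0 xT :: "real^'n"
  assumes "T > 0"
    and "G \<in> simple_graphs"
    and "L \<in> laplacians G"
    and "X = - L"
    and "P = integral {0..T}
           (\<lambda>t. mat_exp (t *\<^sub>R X) ** outer_product x0 x0 ** mat_exp (t *\<^sub>R X))"
    and "xT = mat_exp (T *\<^sub>R X) *v x0"
    and "Q = outer_product xT xT - outer_product x0 x0"
  shows "(reconstruction_solvable T x0 (- L) neg_laplacians
            \<longleftrightarrow> (\<exists>!S. constrained_solution P Q S)) \<and>
         ((\<exists>!S. constrained_solution P Q S) \<longrightarrow>
            (\<forall>S. constrained_solution P Q S \<longrightarrow> S = - L))"
proof -
  let ?x = "trajectory x0 X"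
  have Xsym: "X \<in> sym_matrices"
    using assms(3,4) by (auto simp: laplacians_def qualitative_class_def sym_matrices_def
        transpose_def vec_eq_iff)
  then have "X \<in> map_image neg_laplacians"
    using assms(2-4) by (auto simp: map_image_def neg_laplacians_def)
  moreover have P: "P = integral {0..T} (\<lambda>t. outer_product (?x t) (?x t))"
  proof -
    \<comment> \<open>Symmetry lets the right-hand exponential act on the second factor
      \<open>x0\<close>, so the integrand becomes the outer product of the trajectory with
      itself.\<close>
    have "transpose (mat_exp (t *\<^sub>R X)) = mat_exp (t *\<^sub>R X)" for t
      using Xsym by (simp add: transpose_mat_exp sym_matrices_def transpose_scalar)
    then show ?thesis
      by (simp add: assms(5) matrix_mult_outer_product outer_product_matrix_mult trajectory_def)
  qed
  have Q: "Q = outer_product (?x T) (?x T) - outer_product (?x 0) (?x 0)"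
    unfolding trajectory_0 by (simp add: assms(6,7) trajectory_def)
  have sol: "solves_on T ?x X"
    by (rule solves_on_trajectory)
  \<comment> \<open>The constraints amount to membership in the image, and the matrix equation
    amounts to explaining the trajectory.\<close>
  have iff: "constrained_solution P Q S \<longleftrightarrow> S \<in> map_image neg_laplacians \<and> solves_on T ?x S" for S
    using lyapunov_equation_of_solution[OF _ _ _ P, of S]
      solution_of_lyapunov_equation[OF sol Xsym _ \<open>T > 0\<close> P, of S] \<open>T > 0\<close>
    by (auto simp: constrained_solution_def map_image_neg_laplacians Q)
  \<comment> \<open>Existence thus always holds, with \<open>X\<close> as witness. Unique existence
    then says that every constrained solution equals \<open>X\<close>, which is solvability and also
    identifies the solution as \<open>- L\<close>.\<close>
  ultimately have "constrained_solution P Q X"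
    using sol by blast
  moreover have "reconstruction_solvable T x0 X neg_laplacians
      \<longleftrightarrow> (\<forall>S. constrained_solution P Q S \<longrightarrow> S = X)"
    by (auto simp: reconstruction_solvable_def iff)
  ultimately show ?thesis
    unfolding assms(4)[symmetric] by blast
qed

end
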